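(* Consider the two-tandem-bottleneck corridor with two modes (RV and PV) under queue-eliminating time-varying congestion fees $f^{\mathcal R}(t)$, $f^{\mathcal P}(t)$, as described in the context, with both modes used, i.e. $0<u^{\mathcal P}-c^{\mathcal R}<\beta N/s_{\mathcal C}^{\mathcal R}$. In each of the two cases $s_{\mathcal C}^{\mathcal R}+s_{\mathcal C}^{\mathcal P}\le s_{\mathcal H}$ and $s_{\mathcal C}^{\mathcal R}+s_{\mathcal C}^{\mathcal P}> s_{\mathcal H}$, the optimal congestion pricing scheme (the one minimizing the social cost $SC$) satisfies: 1. (uniform initial fee) $f^{\mathcal R}(\hat t_0^{\mathcal R})=f^{\mathcal P}(\hat t_0^{\mathcal P})$; 2. (identical marginal charge rate) $\dfrac{d f^{\mathcal R}}{dt}$ on $(\hat t_0^{\mathcal R},t^* )$ and $\dfrac{d f^{\mathcal P}}{dt}$ on $(\hat t_0^{\mathcal P},t^* )$ are equal to the same constant; 3. (constant difference in the co-departure phase) $f^{\mathcal R}(t)-f^{\mathcal P}(t)=u^{\mathcal P}-c^{\mathcal R}$ for all $t\in[\hat t_0^{\mathcal P},t^*]$.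
   Context: **Parameters.** $N>0$ commuters with common preferred arrival time $t^*$ travel from home to work through a highway bottleneck of capacity $s_{\mathcal H}$ followed by parallel curbside bottlenecks: one for ride-hailing vehicles (RVs) of capacity $s_{\mathcal C}^{\mathcal R}$, one for private vehicles (PVs) of capacity $s_{\mathcal C}^{\mathcal P}$. Assume $0<s_{\mathcal C}^{\mathcal R}<s_{\mathcal H}$, $0<s_{\mathcal C}^{\mathcal P}<s_{\mathcal H}$. Free-flow travel times are zero. $\beta>0$ is the unit cost of early arrival; late arrival (after $t^*$) is not allowed. $c^{\mathcal R}$ and $u^{\mathcal P}$ are the fixed costs of RV and PV, with $u^{\mathcal P}>c^{\mathcal R}$. **Tolled regime.** Time-varying fees are charged so that no queue occurs at any bottleneck (so departure time from home equals arrival time at work) and bottlenecks are fully utilized. An RV (resp. PV) commuter arriving at time $t$ pays $f^{\mathcal R}(t)$ (resp. $f^{\mathcal P}(t)$). Generalized costs are $$\hat C^{\mathcal R}(t)=\beta(t^*-t)+c^{\mathcal R}+f^{\mathcal R}(t),\ t\in[\hat t_0^{\mathcal R},t^*],\qquad \hat C^{\mathcal P}(t)=\beta(t^*-t)+u^{\mathcal P}+f^{\mathcal P}(t),\ t\in[\hat t_0^{\mathcal P},t^*],$$ where $\hat t_0^{\mathcal R},\hat t_0^{\mathcal P}$ are the arrival times of the first RV and first PV commuters. In the tolled equilibrium all commuters have equal generalized cost: $\hat C^{\mathcal R}$ and $\hat C^{\mathcal P}$ are constant in $t$ on their intervals and equal to each other; in particular $$\beta(t^*-\hat t_0^{\mathcal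 R})+f^{\mathcal R}(\hat t_0^{\mathcal R})+c^{\mathcal R}=\beta(t^*-\hat t_0^{\mathcal P})+f^{\mathcal P}(\hat t_0^{\mathcal P})+u^{\mathcal P}. \quad (\ast)$$ Thus the scheme is determined by the initial fees $f^{\mathcal R}(\hat t_0^{\mathcal R})$ and $f^{\mathcal P}(\hat t_0^{\mathcal P})$. The co-departure phase is $[\hat t_0^{\mathcal P},t^*]$. **Optimal scheme, case $s_{\mathcal C}^{\mathcal R}+s_{\mathcal C}^{\mathcal P}\le s_{\mathcal H}$.** RVs arrive at rate $s_{\mathcal C}^{\mathcal R}$ on $[\hat t_0^{\mathcal R},t^*]$ and PVs at rate $s_{\mathcal C}^{\mathcal P}$ on $[\hat t_0^{\mathcal P},t^*]$. The initial fees are chosen to minimize the social cost $$SC=\int_{\hat t_0^{\mathcal R}}^{t^*}(\hat C^{\mathcal R}-f^{\mathcal R})\,s_{\mathcal C}^{\mathcal R}\,dt+\int_{\hat t_0^{\mathcal P}}^{t^*}(\hat C^{\mathcal P}-f^{\mathcal P})\,s_{\mathcal C}^{\mathcal P}\,dt$$ subject to $(\ast)$, $(t^*-\hat t_0^{\mathcal R})s_{\mathcal C}^{\mathcal R}=N^{\mathcal R}$, $(t^*-\hat t_0^{\mathcal P})s_{\mathcal C}^{\mathcal P}=N^{\mathcal P}$, $N^{\mathcal R}+N^{\mathcal P}=N$, where $N^{\mathcal R},N^{\mathcal P}\ge 0$ are the numbers of RV and PV users. **Optimal scheme, case $s_{\mathcal C}^{\mathcal R}+s_{\mathcal C}^{\mathcal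 P}> s_{\mathcal H}$.** Here $\hat t_0^{\mathcal R}\le\hat t_0^{\mathcal P}\le t^*$. On $[\hat t_0^{\mathcal R},\hat t_0^{\mathcal P})$ only RVs travel, at rate $s_{\mathcal C}^{\mathcal R}$; on $[\hat t_0^{\mathcal P},t^*]$ PVs travel at rate $\theta s_{\mathcal C}^{\mathcal P}$ and RVs at rate $s_{\mathcal H}-\theta s_{\mathcal C}^{\mathcal P}$, with a constant share ratio $\theta\in[(s_{\mathcal H}-s_{\mathcal C}^{\mathcal R})/s_{\mathcal C}^{\mathcal P},1]$. The initial fees and the share ratio $\theta$ are chosen to minimize $$SC=\int_{\hat t_0^{\mathcal R}}^{\hat t_0^{\mathcal P}}(\hat C^{\mathcal R}-f^{\mathcal R})s_{\mathcal C}^{\mathcal R}\,dt+\int_{\hat t_0^{\mathcal P}}^{t^*}(\hat C^{\mathcal R}-f^{\mathcal R})(s_{\mathcal H}-\theta s_{\mathcal C}^{\mathcal P})\,dt+\int_{\hat t_0^{\mathcal P}}^{t^*}(\hat C^{\mathcal P}-f^{\mathcal P})\,\theta s_{\mathcal C}^{\mathcal P}\,dt$$ subject to $(\ast)$, $(\hat t_0^{\mathcal P}-\hat t_0^{\mathcal R})s_{\mathcal C}^{\mathcal R}+(t^*-\hat t_0^{\mathcal P})(s_{\mathcal H}-\theta s_{\mathcal C}^{\mathcal P})=N^{\mathcal R}$, $(t^*-\hat t_0^{\mathcal P})\theta s_{\mathcal C}^{\mathcal P}=N^{\mathcal P}$, $N^{\mathcal R}+N^{\mathcal P}=N$. *)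

theory Defs
  imports "HOL-Analysis.Analysis"
begin

text \<open>
  Superscripts become suffixes: \<open>R\<close> is the ride-hailing mode (RV), \<open>P\<close> the private-vehicle mode
  (PV), \<open>H\<close> the highway. The commuters form a continuum, so their number is real.
\<close>

record corridor =
  demand :: real        \<comment> \<open>\<open>N\<close>\<close>
  pref_time :: real     \<comment> \<open>\<open>t*\<close>\<close>
  cap_H :: real         \<comment> \<open>\<open>s_H\<close>\<close>
  cap_R :: real         \<comment> \<open>\<open>s_C^R\<close>\<close>
  cap_P :: real         \<comment> \<open>\<open>s_C^P\<close>\<close>
  early_cost :: real    \<comment> \<open>\<open>\<beta>\<close>\<close>
  fixed_R :: real       \<comment> \<open>\<open>c^R\<close>\<close>
  fixed_P :: real       \<comment> \<open>\<open>u^P\<close>\<close>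

record toll =
  fee_R :: "real \<Rightarrow> real"
  fee_P :: "real \<Rightarrow> real"
  first_R :: real       \<comment> \<open>arrival time of the first RV commuter\<close>
  first_P :: real       \<comment> \<open>arrival time of the first PV commuter\<close>
  users_R :: real
  users_P :: real

definition gen_cost_R :: "corridor \<Rightarrow> toll \<Rightarrow> real \<Rightarrow> real" where
  "gen_cost_R M S t = early_cost M * (pref_time M - t) + fixed_R M + fee_R S t"

definition gen_cost_P :: "corridor \<Rightarrow> toll \<Rightarrow> real \<Rightarrow> real" where
  "gen_cost_P M S t = early_cost M * (pref_time M - t) + fixed_P M + fee_P S t"

text \<open>
  The last conjunct equates the costs of the first commuters of the two modes; together with
  constancy it makes all generalized costs equal. Fees carry no sign restriction, and their values
  outside the two arrival intervals are irrelevant.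
\<close>

definition tolled_equilibrium :: "corridor \<Rightarrow> toll \<Rightarrow> bool" where
  "tolled_equilibrium M S \<longleftrightarrow>
     gen_cost_R M S constant_on {first_R S..pref_time M} \<and>
     gen_cost_P M S constant_on {first_P S..pref_time M} \<and>
     gen_cost_R M S (first_R S) = gen_cost_P M S (first_P S)"

text \<open>Case \<open>s_C^R + s_C^P \<le> s_H\<close>: both curbside bottlenecks run at capacity.\<close>

definition feasible_sep :: "corridor \<Rightarrow> toll \<Rightarrow> bool" where
  "feasible_sep M S \<longleftrightarrow>
     tolled_equilibrium M S \<and>
     (pref_time M - first_R S) * cap_R M = users_R S \<and>
     (pref_time M - first_P S) * cap_P M = users_P S \<and>
     users_R S + users_P S = demand M \<and>
     0 \<le> users_R S \<and> 0 \<le> users_P S"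

definition social_cost_sep :: "corridor \<Rightarrow> toll \<Rightarrow> real" where
  "social_cost_sep M S =
     integral {first_R S..pref_time M} (\<lambda>t. (gen_cost_R M S t - fee_R S t) * cap_R M) +
     integral {first_P S..pref_time M} (\<lambda>t. (gen_cost_P M S t - fee_P S t) * cap_P M)"

text \<open>
  The initial fees determine the first arrival times and the numbers of users through the
  constraints, so minimizing over the initial fees is minimizing over all feasible tolls.
\<close>

definition optimal_sep :: "corridor \<Rightarrow> toll \<Rightarrow> bool" where
  "optimal_sep M S \<longleftrightarrow> is_arg_min (social_cost_sep M) (feasible_sep M) S"

text \<open>
  Case \<open>s_C^R + s_C^P > s_H\<close>: from \<open>first_P\<close> on the highway capacity is shared by both modes, with
  share ratio \<open>\<theta>\<close>.
\<close>

definition feasible_shared :: "corridor \<Rightarrow> toll \<Rightarrow> real \<Rightarrow> bool" where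
  "feasible_shared M S \<theta> \<longleftrightarrow>
     tolled_equilibrium M S \<and>
     first_R S \<le> first_P S \<and> first_P S \<le> pref_time M \<and>
     \<theta> \<in> {(cap_H M - cap_R M) / cap_P M..1} \<and>
     (first_P S - first_R S) * cap_R M
       + (pref_time M - first_P S) * (cap_H M - \<theta> * cap_P M) = users_R S \<and>
     (pref_time M - first_P S) * (\<theta> * cap_P M) = users_P S \<and>
     users_R S + users_P S = demand M \<and>
     0 \<le> users_R S \<and> 0 \<le> users_P S"

definition social_cost_shared :: "corridor \<Rightarrow> toll \<Rightarrow> real \<Rightarrow> real" where
  "social_cost_shared M S \<theta> =
     integral {first_R S..first_P S} (\<lambda>t. (gen_cost_R M S t - fee_R S t) * cap_R M) +
     integral {first_P S..pref_time M}
       (\<lambda>t. (gen_cost_R M S t - fee_R S t) * (cap_H M - \<theta> * cap_P M)) +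
     integral {first_P S..pref_time M}
       (\<lambda>t. (gen_cost_P M S t - fee_P S t) * (\<theta> * cap_P M))"

definition optimal_shared :: "corridor \<Rightarrow> toll \<Rightarrow> real \<Rightarrow> bool" where
  "optimal_shared M S \<theta> \<longleftrightarrow>
     is_arg_min (\<lambda>(S, \<theta>). social_cost_shared M S \<theta>) (\<lambda>(S, \<theta>). feasible_shared M S \<theta>) (S, \<theta>)"

definition uniform_initial_fee :: "toll \<Rightarrow> bool" where
  "uniform_initial_fee S \<longleftrightarrow> fee_R S (first_R S) = fee_P S (first_P S)"

definition identical_marginal_charge :: "corridor \<Rightarrow> toll \<Rightarrow> bool" where
  "identical_marginal_charge M S \<longleftrightarrow>
     (\<exists>k. (\<forall>t\<in>{first_R S<..<pref_time M}. (fee_R S has_real_derivative k) (at t)) \<and>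
          (\<forall>t\<in>{first_P S<..<pref_time M}. (fee_P S has_real_derivative k) (at t)))"

definition constant_fee_difference :: "corridor \<Rightarrow> toll \<Rightarrow> bool" where
  "constant_fee_difference M S \<longleftrightarrow>
     (\<forall>t\<in>{first_P S..pref_time M}. fee_R S t - fee_P S t = fixed_P M - fixed_R M)"

end

theory Submission
  imports Defs
begin

text \<open>
  Fees are transfers and drop out of the social cost, which therefore depends only on how long each
  mode is used. If the modes are used for the last \<open>x\<close> and \<open>y\<close> units of time before the preferred
  arrival time, at rates \<open>a\<close> and \<open>b\<close>, the social cost is
  \<open>a (\<beta> x^2 / 2 + c x) + b (\<beta> y^2 / 2 + u y)\<close>, to be minimized under \<open>a x + b y = N\<close>. The objective is
  strictly convex, and its unique minimizer equalizes the cost net of fees of the first commuters: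
  \<open>\<beta> x + c = \<beta> y + u\<close> (lemma \<open>mode_cost_strict_min\<close>). The upper bound on \<open>u - c\<close> makes \<open>y\<close>
  positive, so this point satisfies the sign constraints, and \<open>u > c\<close> makes \<open>x > y\<close>. Fees growing at
  rate \<open>\<beta>\<close> from zero implement it as an equilibrium.

  When the highway is shared, the total throughput after the first PV is the highway capacity
  whatever the share ratio, so handing places from PVs to the cheaper RVs lowers the cost without
  moving any arrival time. The best share ratio thus lets RVs run at their curbside capacity
  throughout, and PVs take the rest: the problem becomes the separate one with \<open>b = s_H - s_C^R\<close>
  (lemma \<open>social_cost_shared_ge\<close>).

  In both cases every optimal scheme satisfies \<open>\<beta> x + c = \<beta> y + u\<close>. Since all generalized costs are
  equal, the initial fees are then equal; constancy of the generalized costs forces the common slope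
  \<open>\<beta>\<close>; and subtracting the two generalized costs at the same time leaves \<open>u - c\<close> as the difference of
  the fees (lemma \<open>equalized_first_costs_imp_fee_structure\<close>).
\<close>

section \<open>Social cost as a function of travel durations\<close>

text \<open>
  The integral of \<open>r (\<beta> \<tau> + c)\<close> over \<open>0 \<le> \<tau> \<le> x\<close>: the cost net of fees of all commuters who arrive by
  one mode at rate \<open>r\<close> during the last \<open>x\<close> units of time before the preferred arrival time.
\<close>

definition mode_cost :: "real \<Rightarrow> real \<Rightarrow> real \<Rightarrow> real \<Rightarrow> real" where
  "mode_cost \<beta> c r x = r * (\<beta> * x\<^sup>2 / 2 + c * x)"

lemma integral_linear_cost:
  fixes \<beta> c T s e :: real
  assumes "s \<le> e"
  shows "integral {s..e} (\<lambda>t. \<beta> * (T - t) + c) =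
    mode_cost \<beta> c 1 (T - s) - mode_cost \<beta> c 1 (T - e)"
proof -
  have "((\<lambda>t. \<beta> * (T - t) + c) has_integral
      (- mode_cost \<beta> c 1 (T - e)) - (- mode_cost \<beta> c 1 (T - s))) {s..e}"
  proof (rule fundamental_theorem_of_calculus[OF assms])
    fix t
    have "((\<lambda>t. - mode_cost \<beta> c 1 (T - t)) has_real_derivative
        \<beta> * (T - t) + c) (at t within {s..e})"
      unfolding mode_cost_def
      by (auto intro!: derivative_eq_intros simp: field_simps)
    then show "((\<lambda>t. - mode_cost \<beta> c 1 (T - t)) has_vector_derivative
        \<beta> * (T - t) + c) (at t within {s..e})"
      by (simp add: has_real_derivative_iff_has_vector_derivative)
  qed
  then show ?thesis by (simp add: integral_unique)
qed

lemma social_cost_sep_eq: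
  assumes "first_R S \<le> pref_time M" "first_P S \<le> pref_time M"
  shows "social_cost_sep M S =
    mode_cost (early_cost M) (fixed_R M) (cap_R M) (pref_time M - first_R S) +
    mode_cost (early_cost M) (fixed_P M) (cap_P M) (pref_time M - first_P S)"
  unfolding social_cost_sep_def gen_cost_R_def gen_cost_P_def
  using assms by (simp add: integral_linear_cost) (simp add: mode_cost_def)

text \<open>
  The last summand isolates the influence of the share ratio: each PV in excess of the rate
  \<open>s_H - s_C^R\<close> replaces an RV arriving at the same time, at the extra fixed cost.
\<close>

lemma social_cost_shared_eq:
  assumes "first_R S \<le> first_P S" "first_P S \<le> pref_time M"
  shows "social_cost_shared M S \<theta> =
    mode_cost (early_cost M) (fixed_R M) (cap_R M) (pref_time M - first_R S) +
    mode_cost (early_cost M) (fixed_P M) (cap_H M - cap_R M) (pref_time M - first_P S) +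
    (fixed_P M - fixed_R M) * (pref_time M - first_P S) * (\<theta> * cap_P M - (cap_H M - cap_R M))"
  unfolding social_cost_shared_def gen_cost_R_def gen_cost_P_def
  using assms by (simp add: integral_linear_cost) (simp add: mode_cost_def field_simps)

lemma social_cost_shared_ge:
  assumes "feasible_shared M S \<theta>" "0 < cap_P M" "fixed_R M \<le> fixed_P M"
  shows "social_cost_shared M S \<theta> \<ge>
    mode_cost (early_cost M) (fixed_R M) (cap_R M) (pref_time M - first_R S) +
    mode_cost (early_cost M) (fixed_P M) (cap_H M - cap_R M) (pref_time M - first_P S)"
proof -
  from assms(1) have order: "first_R S \<le> first_P S" "first_P S \<le> pref_time M"
    and "(cap_H M - cap_R M) / cap_P M \<le> \<theta>"
    by (auto simp: feasible_shared_def)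
  with \<open>0 < cap_P M\<close> have "0 \<le> \<theta> * cap_P M - (cap_H M - cap_R M)"
    by (simp add: pos_divide_le_eq)
  with assms(3) order show ?thesis
    by (simp add: social_cost_shared_eq)
qed

section \<open>The cost-minimizing durations\<close>

text \<open>
  By the constraint, the first-order terms of the objective at \<open>(x', y')\<close> are a multiple of the
  difference of the net costs \<open>\<beta> x' + c\<close> and \<open>\<beta> y' + u\<close> and vanish. What remains of the change in the
  objective is the positive definite form \<open>\<beta> / 2 (a (x - x')^2 + b (y - y')^2)\<close>.
\<close>

lemma mode_cost_strict_min:
  fixes \<beta> c u a b x y x' y' :: real
  assumes pos: "0 < \<beta>" "0 < a" "0 < b"
    and same_demand: "a * x + b * y = a * x' + b * y'"
    and equalized: "\<beta> * x' + c = \<beta> * y' + u"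
    and le: "mode_cost \<beta> c a x + mode_cost \<beta> u b y \<le> mode_cost \<beta> c a x' + mode_cost \<beta> u b y'"
  shows "x = x' \<and> y = y'"
proof -
  define p q where "p = x - x'" and "q = y - y'"
  have x: "x = x' + p" and y: "y = y' + q" by (simp_all add: p_def q_def)
  have bq: "b * q = - (a * p)" using same_demand by (simp add: x y algebra_simps)
  have "(mode_cost \<beta> c a x + mode_cost \<beta> u b y) - (mode_cost \<beta> c a x' + mode_cost \<beta> u b y')
      = \<beta> / 2 * (a * p\<^sup>2 + b * q\<^sup>2) + (a * p) * (\<beta> * x' + c) + (b * q) * (\<beta> * y' + u)"
    by (simp add: x y mode_cost_def power2_eq_square field_simps)
  also have "\<dots> = \<beta> / 2 * (a * p\<^sup>2 + b * q\<^sup>2)"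
    by (simp add: bq equalized)
  finally have "\<beta> / 2 * (a * p\<^sup>2 + b * q\<^sup>2) \<le> 0" using le by linarith
  with pos(1) have "a * p\<^sup>2 + b * q\<^sup>2 \<le> 0"
    by (simp add: mult_le_0_iff)
  moreover have "0 \<le> a * p\<^sup>2" "0 \<le> b * q\<^sup>2" using pos by simp_all
  ultimately have "a * p\<^sup>2 = 0" "b * q\<^sup>2 = 0" by linarith+
  with pos show ?thesis by (simp add: p_def q_def)
qed

text \<open>
  The cost condition fixes \<open>x - y\<close> to be \<open>(u - c) / \<beta>\<close>. RVs alone serve the whole demand within
  \<open>N / a\<close>, so the bound on \<open>u - c\<close> says that this head start is too short for RVs to serve everybody.
\<close>

lemma equalizing_durations:
  fixes \<beta> a b N c u :: real
  assumes "0 < \<beta>" "0 < a" "0 < b" "c < u" "u - c < \<beta> * N / a"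
  obtains x y where "\<beta> * x + c = \<beta> * y + u" "a * x + b * y = N" "0 < y" "y < x"
proof -
  define d where "d = (u - c) / \<beta>"
  define y where "y = (N - a * d) / (a + b)"
  have d: "\<beta> * d = u - c" "0 < d" using assms by (simp_all add: d_def)
  have "a * d < N" using assms by (simp add: d_def field_simps)
  with assms have "0 < y" by (simp add: y_def)
  moreover have "a * (y + d) + b * y = N"
  proof -
    have "(a + b) * y = N - a * d" using assms by (simp add: y_def)
    then show ?thesis by (simp add: algebra_simps)
  qed
  moreover have "\<beta> * (y + d) + c = \<beta> * y + u" using d by (simp add: algebra_simps)
  ultimately show thesis using d(2) that[of "y + d" y] by simp
qed

section \<open>Equilibrium fees\<close>

text \<open>
  A toll supporting prescribed durations. Starting both fees at zero gives an equilibrium only for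
  durations that equalize the costs net of fees of the first commuters.
\<close>

definition zero_start_toll :: "corridor \<Rightarrow> real \<Rightarrow> real \<Rightarrow> real \<Rightarrow> real \<Rightarrow> toll" where
  "zero_start_toll M x y nR nP =
     \<lparr>fee_R = (\<lambda>t. early_cost M * (t - (pref_time M - x))),
      fee_P = (\<lambda>t. early_cost M * (t - (pref_time M - y))),
      first_R = pref_time M - x, first_P = pref_time M - y, users_R = nR, users_P = nP\<rparr>"

lemma zero_start_toll_simps [simp]:
  "first_R (zero_start_toll M x y nR nP) = pref_time M - x"
  "first_P (zero_start_toll M x y nR nP) = pref_time M - y"
  "users_R (zero_start_toll M x y nR nP) = nR"
  "users_P (zero_start_toll M x y nR nP) = nP"
  by (simp_all add: zero_start_toll_def)

lemma zero_start_toll_equilibrium: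
  assumes "early_cost M * x + fixed_R M = early_cost M * y + fixed_P M"
  shows "tolled_equilibrium M (zero_start_toll M x y nR nP)"
proof -
  let ?S = "zero_start_toll M x y nR nP"
  have R: "gen_cost_R M ?S t = early_cost M * x + fixed_R M" for t
    by (simp add: gen_cost_R_def zero_start_toll_def algebra_simps)
  have P: "gen_cost_P M ?S t = early_cost M * y + fixed_P M" for t
    by (simp add: gen_cost_P_def zero_start_toll_def algebra_simps)
  show ?thesis
    using assms by (auto simp: tolled_equilibrium_def constant_on_def R P)
qed

lemma affine_on_imp_derivative:
  fixes f :: "real \<Rightarrow> real"
  assumes affine: "\<And>t. t \<in> {s..e} \<Longrightarrow> f t = k * t + m" and t: "t \<in> {s<..<e}"
  shows "(f has_real_derivative k) (at t)"
proof -
  have "((\<lambda>t. k * t + m) has_real_derivative k) (at t)"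
    by (auto intro!: derivative_eq_intros)
  then show ?thesis
    by (rule has_field_derivative_transform_within_open[OF _ open_greaterThanLessThan t])
       (simp add: affine)
qed

text \<open>
  Constancy of the generalized costs determines each fee up to an additive constant, but only while
  its mode is in use. That the RVs start first is what makes the RV formula available on the whole
  co-departure phase.
\<close>

lemma equalized_first_costs_imp_fee_structure:
  assumes eq: "tolled_equilibrium M S"
    and equalized: "early_cost M * (pref_time M - first_R S) + fixed_R M =
      early_cost M * (pref_time M - first_P S) + fixed_P M"
    and order: "first_R S \<le> first_P S" "first_P S \<le> pref_time M"
  shows "uniform_initial_fee S \<and> identical_marginal_charge M S \<and> constant_fee_difference M S"
proof -
  let ?\<beta> = "early_cost M" and ?T = "pref_time M"
  define C where "C = gen_cost_R M S (first_R S)"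
  have C_P: "gen_cost_P M S (first_P S) = C"
    using eq by (simp add: tolled_equilibrium_def C_def)
  have R: "gen_cost_R M S t = C" if "t \<in> {first_R S..?T}" for t
  proof -
    have "first_R S \<in> {first_R S..?T}" using order by simp
    with eq that show ?thesis unfolding tolled_equilibrium_def constant_on_def C_def by metis
  qed
  have P: "gen_cost_P M S t = C" if "t \<in> {first_P S..?T}" for t
  proof -
    have "first_P S \<in> {first_P S..?T}" using order by simp
    with eq that show ?thesis
      unfolding tolled_equilibrium_def constant_on_def C_P[symmetric] by metis
  qed
  have fee_R: "fee_R S t = ?\<beta> * t + (C - ?\<beta> * ?T - fixed_R M)" if "t \<in> {first_R S..?T}" for t
    using R[OF that] by (simp add: gen_cost_R_def algebra_simps)
  have fee_P: "fee_P S t = ?\<beta> * t + (C - ?\<beta> * ?T - fixed_P M)" if "t \<in> {first_P S..?T}" for t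
    using P[OF that] by (simp add: gen_cost_P_def algebra_simps)
  have "uniform_initial_fee S"
    using C_def C_P equalized by (simp add: uniform_initial_fee_def gen_cost_R_def gen_cost_P_def)
  moreover have "identical_marginal_charge M S"
    unfolding identical_marginal_charge_def
    using affine_on_imp_derivative[OF fee_R] affine_on_imp_derivative[OF fee_P] by blast
  moreover have "constant_fee_difference M S"
    using fee_R fee_P order by (simp add: constant_fee_difference_def)
  ultimately show ?thesis by blast
qed

section \<open>Optimal schemes\<close>

text \<open>
  An optimal scheme costs no more than the feasible one with equalizing durations \<open>(x, y)\<close>, whose
  durations are the only cost-minimizing ones.
\<close>

lemma optimal_sep_equalizes:
  assumes pos: "0 < early_cost M" "0 < cap_R M" "0 < cap_P M"
    and opt: "optimal_sep M S"
    and equalized: "early_cost M * x + fixed_R M = early_cost M * y + fixed_P M"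
    and demand: "cap_R M * x + cap_P M * y = demand M"
    and nonneg: "0 \<le> x" "0 \<le> y"
  shows "pref_time M - first_R S = x \<and> pref_time M - first_P S = y"
proof -
  let ?S' = "zero_start_toll M x y (x * cap_R M) (y * cap_P M)"
  have feas: "feasible_sep M S"
    and min: "\<And>S'. feasible_sep M S' \<Longrightarrow> \<not> social_cost_sep M S' < social_cost_sep M S"
    using opt by (auto simp: optimal_sep_def is_arg_min_def)
  have feas': "feasible_sep M ?S'"
    using zero_start_toll_equilibrium[OF equalized] demand nonneg pos
    by (simp add: feasible_sep_def algebra_simps)
  have "0 \<le> (pref_time M - first_R S) * cap_R M" "0 \<le> (pref_time M - first_P S) * cap_P M"
    using feas by (simp_all add: feasible_sep_def)
  with pos have order: "first_R S \<le> pref_time M" "first_P S \<le> pref_time M"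
    by (simp_all add: zero_le_mult_iff)
  have "cap_R M * (pref_time M - first_R S) + cap_P M * (pref_time M - first_P S) =
      cap_R M * x + cap_P M * y"
    using feas demand by (simp add: feasible_sep_def mult.commute)
  moreover have "social_cost_sep M S \<le> social_cost_sep M ?S'"
    using min[OF feas'] by simp
  ultimately show ?thesis
    using mode_cost_strict_min[OF pos _ equalized] order nonneg
    by (simp add: social_cost_sep_eq)
qed

text \<open>
  With the competitor at the smallest share ratio, the lower bound on the social cost is attained, so
  that the comparison of durations is the one for PVs running at rate \<open>s_H - s_C^R\<close>.
\<close>

lemma optimal_shared_equalizes:
  assumes pos: "0 < early_cost M" "0 < cap_R M" "0 < cap_P M" "cap_R M < cap_H M"
    and scarce: "cap_H M < cap_R M + cap_P M"
    and dearer: "fixed_R M \<le> fixed_P M"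
    and opt: "optimal_shared M S \<theta>"
    and equalized: "early_cost M * x + fixed_R M = early_cost M * y + fixed_P M"
    and demand: "cap_R M * x + (cap_H M - cap_R M) * y = demand M"
    and order': "0 \<le> y" "y \<le> x"
  shows "pref_time M - first_R S = x \<and> pref_time M - first_P S = y"
proof -
  let ?b = "cap_H M - cap_R M"
  \<comment> \<open>The smallest admissible share ratio, at which RVs keep their curbside capacity.\<close>
  let ?\<theta>' = "?b / cap_P M"
  let ?S' = "zero_start_toll M x y (x * cap_R M) (y * ?b)"
  have feas: "feasible_shared M S \<theta>"
    and min: "\<And>S' \<theta>'. feasible_shared M S' \<theta>' \<Longrightarrow>
      \<not> social_cost_shared M S' \<theta>' < social_cost_shared M S \<theta>"
    using opt by (auto simp: optimal_shared_def is_arg_min_def)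
  have \<theta>': "?\<theta>' * cap_P M = ?b" "?\<theta>' \<le> 1" using pos scarce by simp_all
  have feas': "feasible_shared M ?S' ?\<theta>'"
    using zero_start_toll_equilibrium[OF equalized] demand order' pos \<theta>'(2)
      mult_left_mono[of "cap_R M" "cap_H M" y]
    unfolding feasible_shared_def \<theta>'(1)
    by (simp add: algebra_simps)
  have "cap_R M * (pref_time M - first_R S) + ?b * (pref_time M - first_P S) = demand M"
    using feas by (simp add: feasible_shared_def algebra_simps)
  then have same: "cap_R M * (pref_time M - first_R S) + ?b * (pref_time M - first_P S) =
      cap_R M * x + ?b * y"
    using demand by simp
  have "mode_cost (early_cost M) (fixed_R M) (cap_R M) (pref_time M - first_R S) +
      mode_cost (early_cost M) (fixed_P M) ?b (pref_time M - first_P S)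
      \<le> social_cost_shared M S \<theta>"
    by (rule social_cost_shared_ge[OF feas pos(3) dearer])
  also have "\<dots> \<le> social_cost_shared M ?S' ?\<theta>'"
    using min[OF feas'] by simp
  also have "\<dots> = mode_cost (early_cost M) (fixed_R M) (cap_R M) x +
      mode_cost (early_cost M) (fixed_P M) ?b y"
    using order' by (subst social_cost_shared_eq) (simp_all only: \<theta>'(1), simp_all)
  finally show ?thesis
    using mode_cost_strict_min[OF pos(1,2) _ same equalized] pos(4) by simp
qed

theorem proposition4:
  fixes M :: corridor
  assumes "demand M > 0"
    and "0 < cap_R M" "cap_R M < cap_H M"
    and "0 < cap_P M" "cap_P M < cap_H M"
    and "early_cost M > 0"
    and "0 < fixed_P M - fixed_R M"
    and "fixed_P M - fixed_R M < early_cost M * demand M / cap_R M"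
  shows
    "(cap_R M + cap_P M \<le> cap_H M \<longrightarrow>
       (\<forall>S. optimal_sep M S \<longrightarrow>
          uniform_initial_fee S \<and> identical_marginal_charge M S \<and> constant_fee_difference M S)) \<and>
     (cap_R M + cap_P M > cap_H M \<longrightarrow>
       (\<forall>S \<theta>. optimal_shared M S \<theta> \<longrightarrow>
          uniform_initial_fee S \<and> identical_marginal_charge M S \<and> constant_fee_difference M S))"
proof (intro conjI[of "_ \<longrightarrow> _"] impI allI)
  fix S
  assume opt: "optimal_sep M S"
  obtain x y where xy: "early_cost M * x + fixed_R M = early_cost M * y + fixed_P M"
      "cap_R M * x + cap_P M * y = demand M" "0 < y" "y < x"
    using equalizing_durations[of "early_cost M" "cap_R M" "cap_P M" "fixed_R M" "fixed_P M" "demand M"]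
      assms by auto
  have "pref_time M - first_R S = x \<and> pref_time M - first_P S = y"
    using optimal_sep_equalizes[OF _ _ _ opt xy(1,2)] assms xy(3,4) by simp
  moreover have "tolled_equilibrium M S"
    using opt by (simp add: optimal_sep_def is_arg_min_def feasible_sep_def)
  ultimately show
    "uniform_initial_fee S \<and> identical_marginal_charge M S \<and> constant_fee_difference M S"
    using xy by (intro equalized_first_costs_imp_fee_structure) auto
next
  fix S \<theta>
  assume scarce: "cap_R M + cap_P M > cap_H M" and opt: "optimal_shared M S \<theta>"
  obtain x y where xy: "early_cost M * x + fixed_R M = early_cost M * y + fixed_P M"
      "cap_R M * x + (cap_H M - cap_R M) * y = demand M" "0 < y" "y < x"
    using equalizing_durations[of "early_cost M" "cap_R M" "cap_H M - cap_R M"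
        "fixed_R M" "fixed_P M" "demand M"] assms by auto
  have "pref_time M - first_R S = x \<and> pref_time M - first_P S = y"
    using optimal_shared_equalizes[OF _ _ _ _ scarce _ opt xy(1,2)] assms xy(3,4) by simp
  moreover have "tolled_equilibrium M S"
    using opt by (simp add: optimal_shared_def is_arg_min_def feasible_shared_def)
  ultimately show
    "uniform_initial_fee S \<and> identical_marginal_charge M S \<and> constant_fee_difference M S"
    using xy by (intro equalized_first_costs_imp_fee_structure) auto
qed

end
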